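(* Let $q_1>p_1\ge2\ge p_2>q_2>1$ be real numbers. Then, for the functions $|\cdot|^{p}:\mathbb{R}\to\mathbb{R}$ with $p\in\{p_1,q_1,p_2,q_2\}$, one has $\alpha(|\cdot|^{p_1})>\alpha(|\cdot|^{q_1})$ and $\alpha(|\cdot|^{p_2})>\alpha(|\cdot|^{q_2})$.
   Context: For a differentiable strictly convex function $h:\mathbb{R}\to\mathbb{R}$ (such as $|\cdot|^p$ with $p>1$), the Bregman distance is $D_h(x,y):=h(x)-h(y)-h'(y)(x-y)$ and the symmetry coefficient is $$\alpha(h):=\inf\left\{\frac{D_h(x,y)}{D_h(y,x)}\;\middle|\;x,y\in\mathbb{R},\ x\neq y\right\}.$$ *)

theory Defs
  imports "HOL-Analysis.Analysis"
begin

definition bregman_dist :: "(real \<Rightarrow> real) \<Rightarrow> real \<Rightarrow> real \<Rightarrow> real" where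
  "bregman_dist h x y = h x - h y - deriv h y * (x - y)"

(* The definition is meant for differentiable strictly convex h. Then bregman_dist h x y > 0
   whenever x is different from y, so no quotient has a zero denominator and the set of
   quotients is nonempty and bounded below by 0: the real infimum is the true one. *)
definition symmetry_coeff :: "(real \<Rightarrow> real) \<Rightarrow> real" where
  "symmetry_coeff h = Inf {bregman_dist h x y / bregman_dist h y x | x y. x \<noteq> y}"

end

theory Submission
  imports Defs
begin

text \<open>
  Write \<open>h\<^sub>p\<close> for the function \<open>\<bar>\<cdot>\<bar> powr p\<close>, \<open>D\<^sub>p\<close> for its Bregman distance and \<open>\<alpha>(p)\<close> for its
  symmetry coefficient. Both halves say that \<open>\<alpha>\<close> decreases strictly as \<open>p\<close> moves away from 2.

  The two halves are equivalent. Up to a positive factor, \<open>h\<^sub>p\<close> and \<open>h\<^sub>r\<close> are convex conjugates when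
  \<open>1/p + 1/r = 1\<close>, and the substitution \<open>x \<mapsto> h\<^sub>r'(x) / r\<close> turns \<open>D\<^sub>r\<close> into a multiple of \<open>D\<^sub>p\<close> with the
  two arguments exchanged (\<open>bregman_dist_signed_powr\<close>). Hence \<open>\<alpha>(p) = \<alpha>(r)\<close>, and since
  \<open>r = p/(p-1)\<close> decreases in \<open>p\<close>, exponents in \<open>]1, 2]\<close> reduce to exponents in \<open>[2, \<infinity>[\<close>.

  Now let \<open>p \<ge> 2\<close>. By homogeneity the quotient \<open>D\<^sub>p(x,y) / D\<^sub>p(y,x)\<close> depends only on \<open>t = x/y\<close>. For
  \<open>t \<ge> -1\<close>, and for \<open>y = 0\<close>, it is at least \<open>1/(p-1)\<close>, by Bernoulli's inequality
  (\<open>bregman_ratio_ge\<close>); and \<open>1/(p-1)\<close> itself is the quotient at \<open>y = 0\<close>. So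
  \<open>\<alpha>(q) \<le> 1/(q-1) < 1/(p-1)\<close> for \<open>q > p\<close>, and the remaining region is \<open>t = -s\<close> with \<open>s > 1\<close>.

  There, apply the decreasing involution \<open>a \<mapsto> (1-a)/(1+a)\<close> to the quotient \<open>u/v\<close> with \<open>u = D\<^sub>p(-s,1)\<close> and \<open>v = D\<^sub>p(1,-s)\<close>. It becomes \<open>(v-u)/(v+u)\<close>, and this equals

    \<open>Q\<^sub>p(s) = (1 - 1/p) T\<^bsub>p-1\<^esub>(s) - T\<^sub>1(s)/p\<close>, where \<open>T\<^sub>a(s) = (s powr a - 1) / (s powr a + 1)\<close>

  (\<open>skewness_eq\<close>).
  Every ingredient is monotone in \<open>p\<close>: \<open>T\<^sub>a(s)\<close> increases with \<open>a\<close>, and the weights \<open>1 - 1/p\<close> and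
  \<open>-1/p\<close> increase with \<open>p\<close>. The weights alone even give a multiplicative gap,
  \<open>Q\<^sub>q(s) \<ge> (1 + 1/p - 1/q) Q\<^sub>p(s)\<close> for \<open>q > p\<close> (\<open>skewness_gap\<close>). Because the factor does not depend
  on \<open>s\<close>, and \<open>\<alpha>(q) < 1\<close> makes the resulting bound \<open>(1 - \<alpha>(q)) / (1 + \<alpha>(q))\<close> on \<open>Q\<^sub>q\<close>
  positive, the strict inequality survives passing to the infimum, and no minimiser has to be located.
\<close>

section \<open>Bregman distances of powers of the absolute value\<close>

text \<open>
  Up to the factor \<open>a + 1\<close>, this is the derivative of \<open>\<bar>x\<bar> powr (a + 1)\<close>.
\<close>
definition signed_powr :: "real \<Rightarrow> real \<Rightarrow> real" where
  "signed_powr a x = sgn x * \<bar>x\<bar> powr a"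

lemma signed_powr_mult: "signed_powr a (x * y) = signed_powr a x * signed_powr a y"
  by (simp add: signed_powr_def sgn_mult abs_mult powr_mult)

lemma signed_powr_times_self: "signed_powr (p - 1) x * x = \<bar>x\<bar> powr p"
proof -
  have "signed_powr (p - 1) x * x = \<bar>x\<bar> powr (p - 1) * \<bar>x\<bar> powr 1"
    by (cases x "0::real" rule: linorder_cases) (simp_all add: signed_powr_def)
  also have "\<dots> = \<bar>x\<bar> powr p"
    unfolding powr_add[symmetric] by simp
  finally show ?thesis .
qed

lemma abs_signed_powr: "x \<noteq> 0 \<or> a \<noteq> 0 \<Longrightarrow> \<bar>signed_powr a x\<bar> = \<bar>x\<bar> powr a"
  by (auto simp: signed_powr_def abs_mult abs_sgn_eq)

lemma signed_powr_signed_powr: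
  assumes "a * b = 1"
  shows "signed_powr a (signed_powr b x) = x"
proof (cases "x = 0")
  case True
  then show ?thesis by (simp add: signed_powr_def)
next
  case False
  have "sgn (signed_powr b x) = sgn x"
    using False by (simp add: signed_powr_def sgn_mult)
  moreover have "\<bar>signed_powr b x\<bar> powr a = \<bar>x\<bar>"
    using False assms by (simp add: abs_signed_powr powr_powr mult.commute)
  ultimately show ?thesis
    by (simp add: signed_powr_def sgn_mult_abs)
qed

lemma has_real_derivative_abs_powr:
  fixes p y :: real
  assumes "p > 1"
  shows "((\<lambda>x. \<bar>x\<bar> powr p) has_real_derivative p * signed_powr (p - 1) y) (at y)"
proof (cases "y = 0")
  case True
  \<comment> \<open>At 0 the difference quotient is \<open>signed_powr (p - 1)\<close> itself.\<close>
  have "((\<lambda>x. \<bar>x\<bar> powr (p - 1)) \<longlongrightarrow> \<bar>0\<bar> powr (p - 1)) (at (0::real))"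
    by (rule tendsto_powr') (use assms in \<open>auto intro!: tendsto_eq_intros\<close>)
  then have "((\<lambda>x. \<bar>x\<bar> powr (p - 1)) \<longlongrightarrow> 0) (at (0::real))"
    using assms by simp
  then have "((\<lambda>x. signed_powr (p - 1) x) \<longlongrightarrow> 0) (at (0::real))"
    by (rule Lim_null_comparison[rotated])
       (simp add: signed_powr_def abs_mult abs_sgn_eq)
  moreover have "(\<bar>x\<bar> powr p - \<bar>0\<bar> powr p) / (x - 0) = signed_powr (p - 1) x" if "x \<noteq> 0" for x
    using that signed_powr_times_self[of p x] by (simp add: field_simps)
  ultimately have "((\<lambda>x. (\<bar>x\<bar> powr p - \<bar>0\<bar> powr p) / (x - 0)) \<longlongrightarrow> 0) (at (0::real))"
    by (auto simp: eventually_at_filter elim!: Lim_transform_eventually)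
  then show ?thesis
    using True by (simp add: has_field_derivative_iff signed_powr_def)
next
  case False
  \<comment> \<open>Near \<open>y\<close> the absolute value is the linear function \<open>x \<mapsto> sgn y * x\<close>.\<close>
  have "((\<lambda>x. (sgn y * x) powr p) has_real_derivative p * signed_powr (p - 1) y) (at y)"
    using False
    by (auto intro!: derivative_eq_intros simp: signed_powr_def sgn_if)
  moreover have "open {x. sgn y * x > 0}"
    by (intro open_Collect_less continuous_intros)
  moreover have "y \<in> {x. sgn y * x > 0}"
    using False by (simp add: sgn_if)
  ultimately show ?thesis
    by (rule has_field_derivative_transform_within_open) (auto simp: sgn_if split: if_splits)
qed

abbreviation bregman_powr :: "real \<Rightarrow> real \<Rightarrow> real \<Rightarrow> real" where
  "bregman_powr p \<equiv> bregman_dist (\<lambda>x. \<bar>x\<bar> powr p)"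

lemma bregman_powr_eq:
  assumes "p > 1"
  shows "bregman_powr p x y
           = \<bar>x\<bar> powr p + (p - 1) * \<bar>y\<bar> powr p - p * (signed_powr (p - 1) y * x)"
  using signed_powr_times_self[of p y]
  by (simp add: bregman_dist_def DERIV_imp_deriv[OF has_real_derivative_abs_powr[OF assms]]
      algebra_simps)

lemma bregman_powr_scale:
  assumes "p > 1"
  shows "bregman_powr p (c * x) (c * y) = \<bar>c\<bar> powr p * bregman_powr p x y"
proof -
  have "signed_powr (p - 1) (c * y) * (c * x)
          = (signed_powr (p - 1) c * c) * (signed_powr (p - 1) y * x)"
    by (simp add: signed_powr_mult)
  also have "\<dots> = \<bar>c\<bar> powr p * (signed_powr (p - 1) y * x)"
    by (simp only: signed_powr_times_self)
  finally have mixed: "signed_powr (p - 1) (c * y) * (c * x)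
                         = \<bar>c\<bar> powr p * (signed_powr (p - 1) y * x)" .
  show ?thesis
    unfolding bregman_powr_eq[OF assms] mixed by (simp add: abs_mult powr_mult algebra_simps)
qed

lemma bregman_powr_one_right:
  "p > 1 \<Longrightarrow> bregman_powr p t 1 = \<bar>t\<bar> powr p - p * t + (p - 1)"
  by (simp add: bregman_powr_eq signed_powr_def)

lemma bregman_powr_one_left:
  "p > 1 \<Longrightarrow> bregman_powr p 1 t = (p - 1) * \<bar>t\<bar> powr p - p * signed_powr (p - 1) t + 1"
  by (simp add: bregman_powr_eq)

text \<open>
  Bernoulli's inequality for a real exponent. It follows from \<open>1 + z \<le> exp z\<close> used twice, for
  \<open>z = (a - 1) ln s\<close> and, in the strict form, for \<open>z = - ln s\<close>, after splitting off one factor \<open>s\<close>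
  from \<open>s powr a\<close>.
\<close>
lemma Bernoulli_powr_strict:
  fixes a s :: real
  assumes "a > 1" "s > 0" "s \<noteq> 1"
  shows "1 + a * (s - 1) < s powr a"
proof -
  have "ln (1 / s) < 1 / s - 1"
    using assms ln_le_minus_one[of "1 / s"] ln_eq_minus_one[of "1 / s"] by fastforce
  then have ln_gt: "1 - 1 / s < ln s"
    using assms by (simp add: ln_div)
  have "1 + a * (s - 1) = s * (1 + (a - 1) * (1 - 1 / s))"
    using assms by (simp add: field_simps)
  also have "\<dots> < s * (1 + (a - 1) * ln s)"
    using ln_gt assms by simp
  also have "\<dots> \<le> s * exp ((a - 1) * ln s)"
    using assms exp_ge_add_one_self[of "(a - 1) * ln s"] by simp
  also have "\<dots> = s powr 1 * s powr (a - 1)"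
    using assms by (simp add: powr_def)
  also have "\<dots> = s powr a"
    unfolding powr_add[symmetric] by simp
  finally show ?thesis .
qed

lemma Bernoulli_powr:
  fixes a s :: real
  assumes "a \<ge> 1" "s > 0"
  shows "1 + a * (s - 1) \<le> s powr a"
  using Bernoulli_powr_strict[of a s] assms by (cases "a = 1 \<or> s = 1") auto

lemma bregman_powr_pos:
  assumes "p > 1" "x \<noteq> y"
  shows "bregman_powr p x y > 0"
proof (cases "y = 0")
  case True
  then show ?thesis
    using assms by (simp add: bregman_powr_eq signed_powr_def)
next
  case False
  define t where "t = x / y"
  have "t \<noteq> 1"
    using assms False by (simp add: t_def)
  consider "t > 0" | "t \<le> 0" by linarith
  then have "bregman_powr p t 1 > 0"
  proof cases
    case 1
    then show ?thesis
      using Bernoulli_powr_strict[of p t] \<open>t \<noteq> 1\<close> assms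
      by (simp add: bregman_powr_one_right algebra_simps)
  next
    case 2
    then have "p * t \<le> 0"
      using assms by (simp add: mult_nonneg_nonpos)
    then show ?thesis
      using assms powr_ge_zero[of "\<bar>t\<bar>" p] unfolding bregman_powr_one_right[OF assms(1)]
      by linarith
  qed
  moreover have "bregman_powr p x y = \<bar>y\<bar> powr p * bregman_powr p t 1"
    using bregman_powr_scale[OF assms(1), of y t 1] False by (simp add: t_def)
  ultimately show ?thesis
    using False by simp
qed

lemma symmetry_coeff_powr_le:
  assumes "p > 1" "x \<noteq> y"
  shows "symmetry_coeff (\<lambda>x. \<bar>x\<bar> powr p) \<le> bregman_powr p x y / bregman_powr p y x"
  unfolding symmetry_coeff_def
proof (rule cInf_lower)
  show "bdd_below {bregman_powr p x y / bregman_powr p y x |x y. x \<noteq> y}"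
    using bregman_powr_pos[OF assms(1)]
    by (intro bdd_belowI[of _ 0]) (auto intro!: less_imp_le divide_pos_pos)
qed (use assms in auto)

lemma symmetry_coeff_powr_ge:
  assumes "\<And>x y. x \<noteq> y \<Longrightarrow> b \<le> bregman_powr p x y / bregman_powr p y x"
  shows "b \<le> symmetry_coeff (\<lambda>x. \<bar>x\<bar> powr p)"
  unfolding symmetry_coeff_def
proof (rule cInf_greatest)
  have "(0::real) \<noteq> 1" by simp
  then show "{bregman_powr p x y / bregman_powr p y x |x y. x \<noteq> y} \<noteq> {}"
    by blast
qed (use assms in auto)

section \<open>Conjugate exponents\<close>

text \<open>
  The instance for powers of the general identity \<open>D\<^sub>h(x, y) = D\<^sub>g(h'(y), h'(x))\<close>, where \<open>g\<close> is the
  convex conjugate of \<open>h\<close>: the signed power is an inverse of the gradient map, up to a scalar.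
\<close>
lemma bregman_dist_signed_powr:
  assumes "p > 1" "r > 1" and conj: "(p - 1) * (r - 1) = 1"
  shows "bregman_powr p (signed_powr (r - 1) x) (signed_powr (r - 1) y)
           = (p - 1) * bregman_powr r y x"
proof -
  have exponent: "(r - 1) * p = r"
    using conj by (simp add: algebra_simps)
  have abs: "\<bar>signed_powr (r - 1) z\<bar> powr p = \<bar>z\<bar> powr r" for z
    using \<open>r > 1\<close> exponent by (simp add: abs_signed_powr powr_powr)
  have "(p - 1) * r = p"
    using conj by (simp add: algebra_simps)
  then have coeff: "(p - 1) * (r * w) = p * w" for w
    by (metis mult.assoc)
  have unit: "(p - 1) * ((r - 1) * w) = w" for w
    using conj by (metis mult.assoc mult_1)
  show ?thesis
    using assms
    by (simp add: bregman_powr_eq abs signed_powr_signed_powr right_diff_distrib distrib_left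
        coeff unit mult.commute[of y])
qed

lemma symmetry_coeff_powr_conjugate_le:
  assumes "p > 1" "r > 1" and conj: "(p - 1) * (r - 1) = 1"
  shows "symmetry_coeff (\<lambda>x. \<bar>x\<bar> powr p) \<le> symmetry_coeff (\<lambda>x. \<bar>x\<bar> powr r)"
proof (rule symmetry_coeff_powr_ge)
  fix x y :: real
  assume "x \<noteq> y"
  let ?\<phi> = "signed_powr (r - 1)"
  have "?\<phi> y \<noteq> ?\<phi> x"
    using \<open>x \<noteq> y\<close> signed_powr_signed_powr[OF conj] by metis
  then have "symmetry_coeff (\<lambda>x. \<bar>x\<bar> powr p)
               \<le> bregman_powr p (?\<phi> y) (?\<phi> x) / bregman_powr p (?\<phi> x) (?\<phi> y)"
    by (rule symmetry_coeff_powr_le[OF \<open>p > 1\<close>])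
  also have "\<dots> = bregman_powr r x y / bregman_powr r y x"
    using \<open>p > 1\<close> by (simp add: bregman_dist_signed_powr[OF assms])
  finally show "symmetry_coeff (\<lambda>x. \<bar>x\<bar> powr p) \<le> bregman_powr r x y / bregman_powr r y x" .
qed

lemma symmetry_coeff_powr_conjugate:
  assumes "p > 1" "r > 1" "(p - 1) * (r - 1) = 1"
  shows "symmetry_coeff (\<lambda>x. \<bar>x\<bar> powr p) = symmetry_coeff (\<lambda>x. \<bar>x\<bar> powr r)"
  using symmetry_coeff_powr_conjugate_le[of p r] symmetry_coeff_powr_conjugate_le[of r p] assms
  by (simp add: mult.commute antisym)

section \<open>Quotients bounded below by the quotient at zero\<close>

lemma bregman_ratio_at_zero:
  assumes "p > 1" "x \<noteq> 0"
  shows "bregman_powr p x 0 / bregman_powr p 0 x = 1 / (p - 1)"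
  using assms by (simp add: bregman_powr_eq signed_powr_def)

lemma bregman_ratio_normalise:
  assumes "p > 1" "y \<noteq> 0"
  shows "bregman_powr p x y / bregman_powr p y x
           = bregman_powr p (x / y) 1 / bregman_powr p 1 (x / y)"
  using bregman_powr_scale[OF assms(1), of y "x / y" 1]
    bregman_powr_scale[OF assms(1), of y 1 "x / y"] assms
  by simp

text \<open>
  After normalising to \<open>y = 1\<close>, the bound \<open>D\<^sub>p(1,t) \<le> (p - 1) D\<^sub>p(t,1)\<close> for \<open>t > 0\<close> is exactly
  Bernoulli's inequality for \<open>t powr (p - 1)\<close>, because the terms in \<open>t powr p\<close> cancel. For
  \<open>-1 \<le> t \<le> 0\<close> even \<open>D\<^sub>p(1,t) \<le> D\<^sub>p(t,1)\<close> holds, term by term.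
\<close>
lemma bregman_ratio_ge:
  assumes "p \<ge> 2" "x \<noteq> y" and "y = 0 \<or> x / y \<ge> -1"
  shows "1 / (p - 1) \<le> bregman_powr p x y / bregman_powr p y x"
proof (cases "y = 0")
  case True
  then show ?thesis
    using assms bregman_ratio_at_zero[of p x] by simp
next
  case False
  have "p > 1" using assms by simp
  define t where "t = x / y"
  have t: "t \<noteq> 1" "t \<ge> -1"
    using assms False by (auto simp: t_def)
  have "bregman_powr p 1 t \<le> (p - 1) * bregman_powr p t 1"
  proof (cases "t > 0")
    case True
    have "p * (1 + (p - 1) * (t - 1)) \<le> p * t powr (p - 1)"
      using Bernoulli_powr[of "p - 1" t] True assms by simp
    moreover have "signed_powr (p - 1) t = t powr (p - 1)" "\<bar>t\<bar> = t"
      using True by (simp_all add: signed_powr_def)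
    ultimately show ?thesis
      using \<open>p > 1\<close> by (simp add: bregman_powr_one_left bregman_powr_one_right algebra_simps)
  next
    case nonpos: False
    define s where "s = - t"
    have s: "0 \<le> s" "s \<le> 1" "\<bar>t\<bar> = s" "t = - s"
      using nonpos t by (auto simp: s_def)
    have signed: "signed_powr (p - 1) t = - (s powr (p - 1))"
      using s by (cases "s = 0") (simp_all add: signed_powr_def)
    have "s powr p \<le> 1"
      using s assms by (simp add: powr_le1)
    then have *: "(p - 2) * s powr p \<le> (p - 2) * 1"
      using assms by (intro mult_left_mono) auto
    have "s powr (p - 1) \<le> s powr 1"
      using s assms by (intro powr_mono') auto
    then have "p * s powr (p - 1) \<le> p * s"
      using s assms by (intro mult_left_mono) auto
    with * have "bregman_powr p 1 t \<le> bregman_powr p t 1"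
      unfolding bregman_powr_one_left[OF \<open>p > 1\<close>] bregman_powr_one_right[OF \<open>p > 1\<close>] signed s(3)
      by (simp add: s(4) algebra_simps del: mult_le_cancel_left_pos mult_le_cancel_left)
    also have "1 * \<dots> \<le> (p - 1) * bregman_powr p t 1"
      using bregman_powr_pos[OF \<open>p > 1\<close> t(1)] assms by (intro mult_right_mono) auto
    finally show ?thesis by simp
  qed
  then have "1 / (p - 1) \<le> bregman_powr p t 1 / bregman_powr p 1 t"
    using bregman_powr_pos[OF \<open>p > 1\<close> t(1)[symmetric]] \<open>p > 1\<close> by (simp add: field_simps)
  then show ?thesis
    using bregman_ratio_normalise[OF \<open>p > 1\<close> False] by (simp add: t_def)
qed

section \<open>Arguments of opposite sign\<close>

text \<open>
  This is \<open>tanh (a * ln s / 2)\<close>, which explains its monotonicity in \<open>a\<close>.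
\<close>
definition powr_tanh :: "real \<Rightarrow> real \<Rightarrow> real" where
  "powr_tanh a s = (s powr a - 1) / (s powr a + 1)"

lemma powr_tanh_nonneg:
  assumes "s \<ge> 1" "a \<ge> 0"
  shows "powr_tanh a s \<ge> 0"
  using assms ge_one_powr_ge_zero[of s a] by (simp add: powr_tanh_def)

lemma powr_tanh_mono:
  assumes "s \<ge> 1" "a \<le> b"
  shows "powr_tanh a s \<le> powr_tanh b s"
proof -
  have "s powr a \<le> s powr b"
    using assms by (intro powr_mono) auto
  moreover have "powr_tanh c s = 1 - 2 / (s powr c + 1)" for c
    using powr_ge_zero[of s c] by (simp add: powr_tanh_def field_simps add_nonneg_eq_0_iff)
  ultimately show ?thesis
    using powr_ge_zero[of s a] by (simp add: frac_le add_nonneg_pos)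
qed

definition skewness :: "real \<Rightarrow> real \<Rightarrow> real" where
  "skewness p s = (1 - 1 / p) * powr_tanh (p - 1) s - powr_tanh 1 s / p"

text \<open>
  With \<open>w = s powr (p - 1)\<close> the sum of the two distances factors as \<open>p (s + 1) (w + 1)\<close>, and their
  difference is \<open>p (s + 1) (w - 1) - 2 (s w - 1)\<close>. Writing \<open>2 (s w - 1)\<close> as
  \<open>(s + 1) (w - 1) + (s - 1) (w + 1)\<close> separates the two variables in the quotient.
\<close>
lemma skewness_eq:
  assumes "p > 1" "s > 0"
  defines "u \<equiv> bregman_powr p (- s) 1" and "v \<equiv> bregman_powr p 1 (- s)"
  shows "(v - u) / (v + u) = skewness p s"
proof -
  define w where "w = s powr (p - 1)"
  have "w > 0" using assms by (simp add: w_def)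
  have "s powr p = s powr 1 * s powr (p - 1)"
    unfolding powr_add[symmetric] by simp
  then have sw: "s powr p = s * w"
    using assms by (simp add: w_def)
  have "u = s * w + p * s + (p - 1)"
    using assms sw by (simp add: u_def bregman_powr_one_right)
  moreover have "v = (p - 1) * (s * w) + p * w + 1"
    using assms sw by (simp add: v_def bregman_powr_one_left signed_powr_def w_def)
  ultimately have sum: "v + u = p * ((s + 1) * (w + 1))"
    and diff: "v - u = (p - 1) * ((s + 1) * (w - 1)) - (s - 1) * (w + 1)"
    by (simp_all add: algebra_simps)
  have split: "((p - 1) * (A * B) - C * E) / (p * (A * E)) = (1 - 1 / p) * (B / E) - C / A / p"
    if "A \<noteq> 0" "E \<noteq> 0" for A B C E :: real
    using that assms(1) by (simp add: field_simps)
  show ?thesis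
    using split[of "s + 1" "w + 1" "w - 1" "s - 1"] assms(2) \<open>w > 0\<close>
    unfolding sum diff skewness_def powr_tanh_def w_def[symmetric] by simp
qed

text \<open>
  Only the change of the weights contributes to the factor: raising \<open>p\<close> to \<open>q\<close> adds
  \<open>1/p - 1/q\<close> to each of them, hence \<open>1/p - 1/q\<close> times the sum of the two hyperbolic tangents to
  the skewness, and this sum dominates \<open>skewness p s\<close>.
\<close>
lemma skewness_gap:
  assumes "1 < p" "p \<le> q" "s \<ge> 1"
  shows "(1 + (1 / p - 1 / q)) * skewness p s \<le> skewness q s"
proof -
  define c where "c = 1 / p - 1 / q"
  have "c \<ge> 0"
    using assms by (simp add: c_def frac_le)
  let ?T = "powr_tanh (p - 1) s" and ?U = "powr_tanh 1 s"
  have nonneg: "?T \<ge> 0" "?U \<ge> 0"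
    using assms by (simp_all add: powr_tanh_nonneg)
  have "skewness p s = ?T - (?T + ?U) / p"
    by (simp add: skewness_def field_simps add_divide_distrib)
  also have "\<dots> \<le> ?T + ?U"
    using nonneg assms by (smt (verit) divide_nonneg_pos)
  finally have "c * skewness p s \<le> c * (?T + ?U)"
    using \<open>c \<ge> 0\<close> by (rule mult_left_mono)
  moreover have "skewness p s + c * (?T + ?U) = (1 - 1 / q) * ?T - ?U / q"
    by (simp add: skewness_def c_def algebra_simps)
  moreover have "(1 - 1 / q) * ?T \<le> (1 - 1 / q) * powr_tanh (q - 1) s"
    using assms by (intro mult_left_mono powr_tanh_mono) auto
  ultimately have "skewness p s + c * skewness p s \<le> skewness q s"
    unfolding skewness_def[of q] by linarith
  then show ?thesis
    by (simp add: c_def distrib_right)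
qed

text \<open>
  The map \<open>a \<mapsto> (1 - a) / (1 + a)\<close> is a decreasing involution; it translates lower bounds on
  quotients of Bregman distances into upper bounds on the skewness.
\<close>
lemma ratio_ge_iff_skew_le:
  fixes a u v :: real
  assumes "u > 0" "v > 0" "a > -1"
  shows "a \<le> u / v \<longleftrightarrow> (v - u) / (v + u) \<le> (1 - a) / (1 + a)"
proof -
  have "(v - u) / (v + u) \<le> (1 - a) / (1 + a) \<longleftrightarrow> (v - u) * (1 + a) \<le> (1 - a) * (v + u)"
    using assms by (simp add: pos_le_divide_eq pos_divide_le_eq)
  also have "\<dots> \<longleftrightarrow> a * v \<le> u"
    by (auto simp: algebra_simps)
  also have "\<dots> \<longleftrightarrow> a \<le> u / v"
    using assms by (simp add: pos_le_divide_eq)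
  finally show ?thesis ..
qed

lemma bregman_ratio_ge_iff_skewness_le:
  assumes "p > 1" "s > 0" "a > -1"
  shows "a \<le> bregman_powr p (- s) 1 / bregman_powr p 1 (- s)
           \<longleftrightarrow> skewness p s \<le> (1 - a) / (1 + a)"
  using ratio_ge_iff_skew_le[of "bregman_powr p (- s) 1" "bregman_powr p 1 (- s)" a]
    bregman_powr_pos[of p "- s" 1] bregman_powr_pos[of p 1 "- s"] skewness_eq[of p s] assms
  by simp

section \<open>Monotonicity of the symmetry coefficient\<close>

lemma symmetry_coeff_powr_strict_antimono:
  assumes "2 \<le> p" "p < q"
  shows "symmetry_coeff (\<lambda>x. \<bar>x\<bar> powr q) < symmetry_coeff (\<lambda>x. \<bar>x\<bar> powr p)"
proof -
  have gt1: "p > 1" "q > 1" using assms by auto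
  define a where "a = symmetry_coeff (\<lambda>x. \<bar>x\<bar> powr q)"
  have "a \<le> 1 / (q - 1)"
    using symmetry_coeff_powr_le[of q 1 0] bregman_ratio_at_zero[of q 1] gt1 by (simp add: a_def)
  also have "\<dots> < 1 / (p - 1)"
    using assms by (simp add: frac_less2)
  finally have a_less: "a < 1 / (p - 1)" .
  also have "\<dots> \<le> 1" using assms by simp
  finally have "a < 1" .
  have "a \<ge> 0"
    unfolding a_def
    by (rule symmetry_coeff_powr_ge)
       (use bregman_powr_pos[OF gt1(2)] in \<open>auto intro!: less_imp_le divide_pos_pos\<close>)
  \<comment> \<open>\<open>g\<close> bounds the skewness for \<open>q\<close>, hence \<open>g'\<close> bounds that for \<open>p\<close>, and \<open>b\<close> is the
    corresponding lower bound on the quotients for \<open>p\<close>.\<close>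
  define g where "g = (1 - a) / (1 + a)"
  define k where "k = 1 + (1 / p - 1 / q)"
  define g' where "g' = g / k"
  define b where "b = (1 - g') / (1 + g')"
  have "k > 1"
    using assms by (simp add: k_def frac_less2)
  have "0 < g" "g \<le> 1"
    using \<open>0 \<le> a\<close> \<open>a < 1\<close> by (auto simp: g_def)
  then have "0 < g'" "g' < g"
    using \<open>k > 1\<close> by (auto simp: g'_def divide_less_eq)
  have involution: "(1 - (1 - z) / (1 + z)) / (1 + (1 - z) / (1 + z)) = z" if "z \<ge> 0" for z :: real
    using that by (simp add: field_simps)
  have "a < b"
  proof -
    have "a = (1 - g) / (1 + g)"
      using involution[OF \<open>0 \<le> a\<close>] by (simp add: g_def)
    also have "\<dots> < b"
      using \<open>0 < g'\<close> \<open>g' < g\<close> by (simp add: b_def field_simps)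
    finally show ?thesis .
  qed
  have g'_eq: "g' = (1 - b) / (1 + b)"
    using involution[of g'] \<open>0 < g'\<close> by (simp add: b_def)
  have "min b (1 / (p - 1)) \<le> bregman_powr p x y / bregman_powr p y x" if "x \<noteq> y" for x y
  proof (cases "y = 0 \<or> x / y \<ge> -1")
    case True
    then show ?thesis
      using bregman_ratio_ge[OF assms(1) that] by (simp add: min.coboundedI2)
  next
    case False
    define s where "s = - (x / y)"
    have "s > 1" "x / y = - s" "y \<noteq> 0"
      using False by (auto simp: s_def)
    have "a \<le> bregman_powr q (- s) 1 / bregman_powr q 1 (- s)"
      unfolding a_def using \<open>s > 1\<close> gt1 by (intro symmetry_coeff_powr_le) auto
    then have "skewness q s \<le> g"
      using bregman_ratio_ge_iff_skewness_le[of q s a] \<open>s > 1\<close> gt1 \<open>0 \<le> a\<close> by (simp add: g_def)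
    then have "k * skewness p s \<le> g"
      using skewness_gap[of p q s] assms \<open>s > 1\<close> by (simp add: k_def)
    then have "skewness p s \<le> g'"
      using \<open>k > 1\<close> by (simp add: g'_def pos_le_divide_eq mult.commute)
    then have "b \<le> bregman_powr p (- s) 1 / bregman_powr p 1 (- s)"
      using bregman_ratio_ge_iff_skewness_le[of p s b] \<open>s > 1\<close> gt1 \<open>0 \<le> a\<close> \<open>a < b\<close>
      by (simp add: g'_eq)
    then show ?thesis
      using bregman_ratio_normalise[OF gt1(1) \<open>y \<noteq> 0\<close>, of x] \<open>x / y = - s\<close> by simp
  qed
  then have "min b (1 / (p - 1)) \<le> symmetry_coeff (\<lambda>x. \<bar>x\<bar> powr p)"
    by (rule symmetry_coeff_powr_ge)
  then show ?thesis
    using \<open>a < b\<close> a_less by (simp add: a_def)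
qed

lemma symmetry_coeff_powr_strict_mono:
  assumes "1 < q" "q < p" "p \<le> 2"
  shows "symmetry_coeff (\<lambda>x. \<bar>x\<bar> powr q) < symmetry_coeff (\<lambda>x. \<bar>x\<bar> powr p)"
proof -
  define conj where "conj z = 1 + 1 / (z - 1)" for z :: real
  have conj: "symmetry_coeff (\<lambda>x. \<bar>x\<bar> powr z) = symmetry_coeff (\<lambda>x. \<bar>x\<bar> powr conj z)"
    if "z > 1" for z
    using that by (intro symmetry_coeff_powr_conjugate) (auto simp: conj_def)
  have "2 \<le> conj p"
    using assms by (simp add: conj_def)
  moreover have "conj p < conj q"
    using assms by (simp add: conj_def frac_less2)
  ultimately show ?thesis
    using symmetry_coeff_powr_strict_antimono conj[of p] conj[of q] assms by simp
qed

theorem corollary4p3: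
  fixes p\<^sub>1 q\<^sub>1 p\<^sub>2 q\<^sub>2 :: real
  assumes "q\<^sub>1 > p\<^sub>1" and "p\<^sub>1 \<ge> 2" and "2 \<ge> p\<^sub>2" and "p\<^sub>2 > q\<^sub>2" and "q\<^sub>2 > 1"
  shows "symmetry_coeff (\<lambda>x. \<bar>x\<bar> powr p\<^sub>1) > symmetry_coeff (\<lambda>x. \<bar>x\<bar> powr q\<^sub>1) \<and>
         symmetry_coeff (\<lambda>x. \<bar>x\<bar> powr p\<^sub>2) > symmetry_coeff (\<lambda>x. \<bar>x\<bar> powr q\<^sub>2)"
  using symmetry_coeff_powr_strict_antimono[of p\<^sub>1 q\<^sub>1] symmetry_coeff_powr_strict_mono[of q\<^sub>2 p\<^sub>2]
    assms by simp

end
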